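(* Let $n\ge3$, $l\ge5$ and $0\le\alpha<1$. Let $H$ be a connected linear $3$-graph on $n$ vertices with maximum degree $\Delta$. If $H$ is Berge-$C_l$-free, then $$\rho_\alpha^2(H)\le \alpha\Delta^2+(1-\alpha)\left[\frac{(2l-7)(n-1)}{4}+(2l-3)\Delta\right].$$
   Context: A $k$-graph ($k$-uniform hypergraph) $H$ consists of a finite vertex set $V(H)$ and a set $E(H)$ of $k$-element subsets of $V(H)$ (edges). $H$ is linear if any two distinct edges share at most one vertex. Two vertices are adjacent if some edge contains both; $H$ is connected if the graph on $V(H)$ with this adjacency relation is connected. The degree $d_v$ of a vertex $v$ is the number of edges containing $v$. For $V(H)=\{v_1,\dots,v_n\}$, the adjacency tensor $\mathcal{A}(H)=(a_{i_1\dots i_k})$ is the order-$k$, dimension-$n$ tensor with $a_{i_1\dots i_k}=\frac{1}{(k-1)!}$ if $\{v_{i_1},\dots,v_{i_k}\}\in E(H)$ and $0$ otherwise; $\mathcal{D}(H)$ is the diagonal tensor with entries $d_{i\dots i}=d_{v_i}$ and all other entries $0$. For $0\le\alpha<1$, $\mathcal{A}_\alpha(H)=\alpha\mathcal{D}(H)+(1-\alpha)\mathcal{A}(H)$. A number $\lambda\in\mathbb{C}$ is an eigenvalue of an order-$k$ dimension-$n$ tensor $\mathcal{A}=(a_{i_1\dots i_k})$ if there is a nonzero $\mathbf{x}\in\mathbb{C}^n$ with $\sum_{i_2,\dots,i_k=1}^n a_{i i_2\dots i_k}x_{i_2}\cdots x_{i_k}=\lambda x_i^{k-1}$ for all $i$;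 the spectral radius is the largest modulus of an eigenvalue. $\rho_\alpha(H)$ denotes the spectral radius of $\mathcal{A}_\alpha(H)$. For a graph $G$, a hypergraph $F$ is a Berge-$G$ if there is a bijection $\varphi:E(G)\to E(F)$ with $e\subseteq\varphi(e)$ for every $e\in E(G)$. $H$ is Berge-$G$-free if no subhypergraph of $H$ is a Berge-$G$. $C_l$ denotes the cycle of length $l$. *)

theory Defs imports Complex_Main begin

definition k_graph :: "nat \<Rightarrow> 'a set \<Rightarrow> 'a set set \<Rightarrow> bool" where
  "k_graph k V E \<longleftrightarrow> finite V \<and> (\<forall>e\<in>E. e \<subseteq> V \<and> card e = k)"

definition linear_hypergraph :: "'a set set \<Rightarrow> bool" where
  "linear_hypergraph E \<longleftrightarrow> (\<forall>e\<in>E. \<forall>f\<in>E. e \<noteq> f \<longrightarrow> card (e \<inter> f) \<le> 1)"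

definition adjacency :: "'a set \<Rightarrow> 'a set set \<Rightarrow> ('a \<times> 'a) set" where
  "adjacency V E = {(u, v). u \<in> V \<and> v \<in> V \<and> u \<noteq> v \<and> (\<exists>e\<in>E. u \<in> e \<and> v \<in> e)}"

definition connected_hypergraph :: "'a set \<Rightarrow> 'a set set \<Rightarrow> bool" where
  "connected_hypergraph V E \<longleftrightarrow> (\<forall>u\<in>V. \<forall>v\<in>V. (u, v) \<in> (adjacency V E)\<^sup>*)"

definition degree :: "'a set set \<Rightarrow> 'a \<Rightarrow> nat" where
  "degree E v = card {e \<in> E. v \<in> e}"

definition max_degree :: "'a set \<Rightarrow> 'a set set \<Rightarrow> nat" where
  "max_degree V E = Max (degree E ` V)"

text \<open>A tensor of order \<open>k\<close> whose coordinates are indexed by a finite set \<open>V\<close>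
  (so its dimension is \<open>card V\<close>) is a function on lists; only its values at
  lists of length \<open>k\<close> with entries in \<open>V\<close> are relevant.\<close>

type_synonym 'a tensor = "'a list \<Rightarrow> complex"

definition adjacency_tensor :: "nat \<Rightarrow> 'a set set \<Rightarrow> 'a tensor" where
  "adjacency_tensor k E is = (if set is \<in> E then 1 / fact (k - 1) else 0)"

definition degree_tensor :: "nat \<Rightarrow> 'a set set \<Rightarrow> 'a tensor" where
  "degree_tensor k E is =
     (if is = replicate k (hd is) then of_nat (degree E (hd is)) else 0)"

definition A_alpha_tensor :: "real \<Rightarrow> nat \<Rightarrow> 'a set set \<Rightarrow> 'a tensor" where
  "A_alpha_tensor \<alpha> k E is =
     of_real \<alpha> * degree_tensor k E is + of_real (1 - \<alpha>) * adjacency_tensor k E is"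

definition tensor_eigenvalue :: "nat \<Rightarrow> 'a set \<Rightarrow> 'a tensor \<Rightarrow> complex \<Rightarrow> bool" where
  "tensor_eigenvalue k V T \<mu> \<longleftrightarrow>
     (\<exists>x :: 'a \<Rightarrow> complex. (\<exists>i\<in>V. x i \<noteq> 0) \<and>
        (\<forall>i\<in>V. (\<Sum>is \<in> {is. set is \<subseteq> V \<and> length is = k - 1}.
                   T (i # is) * prod_list (map x is)) = \<mu> * x i ^ (k - 1)))"

text \<open>\<open>Sup\<close> rather than \<open>Max\<close>, so that finiteness of the spectrum is not presupposed. For finite
  \<open>V\<close> the set of moduli is compact (normalise the eigenvectors), so whenever an eigenvalue exists
  the supremum is attained and is the largest modulus.\<close>

definition tensor_spectral_radius :: "nat \<Rightarrow> 'a set \<Rightarrow> 'a tensor \<Rightarrow> real" where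
  "tensor_spectral_radius k V T = Sup {cmod \<mu> | \<mu>. tensor_eigenvalue k V T \<mu>}"

definition rho_alpha :: "real \<Rightarrow> nat \<Rightarrow> 'a set \<Rightarrow> 'a set set \<Rightarrow> real" where
  "rho_alpha \<alpha> k V E = tensor_spectral_radius k V (A_alpha_tensor \<alpha> k E)"

definition subhypergraph :: "'a set \<Rightarrow> 'a set set \<Rightarrow> 'a set \<Rightarrow> 'a set set \<Rightarrow> bool" where
  "subhypergraph W F V E \<longleftrightarrow> W \<subseteq> V \<and> F \<subseteq> E \<and> (\<forall>e\<in>F. e \<subseteq> W)"

text \<open>The graph is understood up to isomorphism: \<open>f\<close> places its vertices among those of the
  hypergraph, after which \<open>e \<subseteq> \<phi> e\<close> makes sense.\<close>

definition is_Berge :: "'b set \<Rightarrow> 'b set set \<Rightarrow> 'a set \<Rightarrow> 'a set set \<Rightarrow> bool" where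
  "is_Berge VG EG W F \<longleftrightarrow>
     (\<exists>f \<phi>. inj_on f VG \<and> f ` VG \<subseteq> W \<and> bij_betw \<phi> EG F \<and> (\<forall>e\<in>EG. f ` e \<subseteq> \<phi> e))"

definition Berge_free :: "'b set \<Rightarrow> 'b set set \<Rightarrow> 'a set \<Rightarrow> 'a set set \<Rightarrow> bool" where
  "Berge_free VG EG V E \<longleftrightarrow>
     \<not> (\<exists>W F. subhypergraph W F V E \<and> is_Berge VG EG W F)"

definition cycle_verts :: "nat \<Rightarrow> nat set" where
  "cycle_verts l = {..<l}"

definition cycle_edges :: "nat \<Rightarrow> nat set set" where
  "cycle_edges l = {{i, (i + 1) mod l} | i. i < l}"

end

theory Submission imports Defs "HOL-Analysis.Convex" begin

text \<open>If \<open>x\<close> is an eigenvector for \<open>\<mu>\<close> and \<open>z = |x|\<^sup>2\<close>, the AM-GM inequality on each edge gives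
  \<open>|\<mu>| z \<le> \<alpha> D z + (1 - \<alpha>) A z / 2\<close> with \<open>A\<close> the adjacency matrix of the shadow graph. By convexity
  of the square, \<open>|\<mu>|\<^sup>2 \<le> \<alpha> \<Delta>\<^sup>2 + (1 - \<alpha>) R / 4\<close>, where \<open>R\<close> is the largest row sum of \<open>A\<^sup>2\<close>, that
  is, the maximum over \<open>v\<close> of twice the degree sum of the neighbours of \<open>v\<close>.

  To bound this degree sum, split the edges that avoid \<open>v\<close> and meet its neighbourhood \<open>N\<close> into
  those with exactly one vertex in \<open>N\<close> (hence two outside) and those with at least two in \<open>N\<close>.
  If either class had more than \<open>(2 l - 7) / 2\<close> edges per vertex of \<open>V - N - {v}\<close>, respectively
  of \<open>N\<close>, a subset of large minimum degree would yield a Berge path with \<open>l - 2\<close> edges joining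
  two vertices of \<open>N\<close> from different edges at \<open>v\<close>, and hence a Berge cycle of length \<open>l\<close>
  through \<open>v\<close>.\<close>

section \<open>Subsets of large minimum degree\<close>

text \<open>Such an edge can carry a path step between two vertices of \<open>X\<close>; it may also
  have vertices outside \<open>X\<close>.\<close>

definition dense_edges :: "'a set set \<Rightarrow> 'a set \<Rightarrow> 'a set set" where
  "dense_edges F X = {f \<in> F. 2 \<le> card (f \<inter> X)}"

text \<open>Take a smallest \<open>Y\<close> with more than \<open>c / 2\<close> dense edges per
  vertex. Deleting \<open>y\<close> destroys only dense edges through \<open>y\<close>, by
  minimality more than \<open>c / 2\<close> of them. Each dense edge counts at least twice in the
  degree sum, so the average degree exceeds \<open>c\<close>.\<close>

lemma dense_subset_exists:
  fixes F :: "'a set set" and c :: nat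
  assumes "finite F" "finite X" "c * card X < 2 * card (dense_edges F X)"
  obtains Y x where "Y \<subseteq> X" "x \<in> Y" "c < degree (dense_edges F Y) x"
    "\<And>y. y \<in> Y \<Longrightarrow> c < 2 * degree (dense_edges F Y) y"
proof -
  let ?P = "\<lambda>Y. Y \<subseteq> X \<and> c * card Y < 2 * card (dense_edges F Y)"
  obtain Y where Y: "?P Y" and min: "\<And>Z. ?P Z \<Longrightarrow> card Y \<le> card Z"
    using ex_has_least_nat[of ?P X card] assms(3) by blast
  have finY: "finite Y" using Y assms(2) finite_subset by blast
  have fin: "finite (dense_edges F Z)" for Z using assms(1) by (simp add: dense_edges_def)
  have low: "c < 2 * degree (dense_edges F Y) y" if y: "y \<in> Y" for y
  proof -
    have "card (Y - {y}) < card Y" using finY y by (rule card_Diff1_less)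
    then have "2 * card (dense_edges F (Y - {y})) \<le> c * card (Y - {y})"
      using min[of "Y - {y}"] Y by force
    moreover have "dense_edges F Y \<subseteq> dense_edges F (Y - {y}) \<union> {f \<in> dense_edges F Y. y \<in> f}"
    proof
      fix f assume f: "f \<in> dense_edges F Y"
      show "f \<in> dense_edges F (Y - {y}) \<union> {f \<in> dense_edges F Y. y \<in> f}"
      proof (cases "y \<in> f")
        case False
        then have "f \<inter> (Y - {y}) = f \<inter> Y" by blast
        then show ?thesis using f by (simp add: dense_edges_def)
      qed (use f in simp)
    qed
    then have "card (dense_edges F Y)
        \<le> card (dense_edges F (Y - {y}) \<union> {f \<in> dense_edges F Y. y \<in> f})"
      using fin by (intro card_mono) auto
    then have "card (dense_edges F Y)
        \<le> card (dense_edges F (Y - {y})) + degree (dense_edges F Y) y"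
      unfolding degree_def by (meson card_Un_le order_trans)
    moreover have "c * card Y = c * card (Y - {y}) + c"
      using card_Suc_Diff1[OF finY y] by (metis add.commute mult_Suc_right)
    ultimately show ?thesis using Y by linarith
  qed
  have "\<exists>x\<in>Y. c < degree (dense_edges F Y) x"
  proof (rule ccontr)
    assume "\<not> ?thesis"
    then have "(\<Sum>x\<in>Y. degree (dense_edges F Y) x) \<le> (\<Sum>x\<in>Y. c)"
      by (intro sum_mono) (auto simp: not_less)
    moreover have "(\<Sum>x\<in>Y. degree (dense_edges F Y) x)
        = (\<Sum>f\<in>dense_edges F Y. card {x \<in> Y. x \<in> f})"
      unfolding degree_def
      by (rule sum_multicount_gen) (use finY fin in auto)
    moreover have "(\<Sum>f\<in>dense_edges F Y. 2) \<le> (\<Sum>f\<in>dense_edges F Y. card {x \<in> Y. x \<in> f})"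
    proof (rule sum_mono)
      fix f assume "f \<in> dense_edges F Y"
      moreover have "{x \<in> Y. x \<in> f} = f \<inter> Y" by blast
      ultimately show "2 \<le> card {x \<in> Y. x \<in> f}" by (simp add: dense_edges_def)
    qed
    ultimately show False using Y by (simp add: mult.commute)
  qed
  then show ?thesis using that Y low by blast
qed

section \<open>Berge paths and Berge cycles\<close>

text \<open>Paths are lists that grow at the head, so \<open>hd xs\<close> is the active
  end.\<close>

definition berge_path :: "'a list \<Rightarrow> 'a set list \<Rightarrow> bool" where
  "berge_path xs es \<longleftrightarrow> distinct xs \<and> distinct es \<and> length xs = Suc (length es) \<and>
     (\<forall>i<length es. xs ! i \<in> es ! i \<and> xs ! Suc i \<in> es ! i)"

text \<open>Reversal makes the other end available for extension.\<close>

lemma berge_path_rev: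
  assumes "berge_path xs es"
  shows "berge_path (rev xs) (rev es)"
  unfolding berge_path_def
proof (intro conjI allI impI)
  fix i assume i: "i < length (rev es)"
  let ?j = "length es - Suc i"
  have j: "?j < length es" "rev es ! i = es ! ?j" "rev xs ! i = xs ! Suc ?j" "rev xs ! Suc i = xs ! ?j"
    using i assms by (auto simp: berge_path_def rev_nth Suc_diff_Suc)
  then show "rev xs ! i \<in> rev es ! i" "rev xs ! Suc i \<in> rev es ! i"
    using assms by (auto simp: berge_path_def)
qed (use assms in \<open>auto simp: berge_path_def\<close>)

lemma berge_path_Cons:
  assumes "berge_path xs es" "hd xs \<in> f" "y \<in> f" "y \<notin> set xs" "f \<notin> set es"
  shows "berge_path (y # xs) (f # es)"
proof -
  have "xs \<noteq> []" using assms(1) by (auto simp: berge_path_def)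
  then have "xs ! 0 \<in> f" using assms(2) by (simp add: hd_conv_nth)
  then show ?thesis using assms by (auto simp: berge_path_def nth_Cons split: nat.splits)
qed

lemma berge_path_edge_meets_tl:
  assumes "berge_path xs es" "f \<in> set es"
  shows "f \<inter> set (tl xs) \<noteq> {}"
proof -
  obtain i where i: "i < length es" "f = es ! i" using assms(2) by (metis in_set_conv_nth)
  then have "xs ! Suc i \<in> f" "i < length (tl xs)" "tl xs ! i = xs ! Suc i"
    using assms(1) by (auto simp: berge_path_def nth_tl)
  then show ?thesis by (metis disjoint_iff nth_mem)
qed

text \<open>An edge of the cycle determines its index. For \<open>l = 2\<close> both indices would
  give the same pair.\<close>

lemma inj_on_cycle_edge:
  fixes l :: nat
  assumes "l \<ge> 3"
  shows "inj_on (\<lambda>i. {i, (i + 1) mod l}) {..<l}"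
proof (rule inj_onI)
  fix i j :: nat
  assume "i \<in> {..<l}" "j \<in> {..<l}" and eq: "{i, (i + 1) mod l} = {j, (j + 1) mod l}"
  then have "i < l" "j < l" by auto
  moreover have "(k + 1) mod l = (if k + 1 = l then 0 else k + 1)" if "k < l" for k
    using that by auto
  ultimately show "i = j" using eq assms by (auto simp: doubleton_eq_iff split: if_splits)
qed

text \<open>Vertex \<open>i\<close> of the cycle is placed at \<open>xs ! i\<close>, its edge number
  \<open>i\<close> goes to entry \<open>i\<close> of \<open>es\<close>, and the wrap-around edge
  goes to \<open>e\<close>.\<close>

lemma berge_cycle_not_free:
  assumes path: "berge_path xs es" and len: "length xs = l" and "l \<ge> 3"
    and "set xs \<subseteq> V" "set es \<subseteq> E" "\<And>e. e \<in> E \<Longrightarrow> e \<subseteq> V"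
    and e: "e \<in> E" "e \<notin> set es" "hd xs \<in> e" "last xs \<in> e"
  shows "\<not> Berge_free (cycle_verts l) (cycle_edges l) V E"
proof -
  let ?c = "\<lambda>i. {i, (i + 1) mod l}" and ?gs = "es @ [e]"
  let ?\<phi> = "\<lambda>p. ?gs ! inv_into {..<l} ?c p"
  have inj: "inj_on ?c {..<l}" using \<open>l \<ge> 3\<close> by (rule inj_on_cycle_edge)
  have edges: "cycle_edges l = ?c ` {..<l}" by (auto simp: cycle_edges_def)
  have leng: "length ?gs = l" using path len by (simp add: berge_path_def)
  have "bij_betw (inv_into {..<l} ?c) (cycle_edges l) {..<l}"
    unfolding edges using inj by (intro bij_betw_inv_into) (simp add: bij_betw_def)
  moreover have "bij_betw ((!) ?gs) {..<l} (set ?gs)"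
    using path e leng by (intro bij_betw_nth) (auto simp: berge_path_def)
  ultimately have bij: "bij_betw ?\<phi> (cycle_edges l) (set ?gs)"
    using bij_betw_trans[of "inv_into {..<l} ?c" "cycle_edges l" "{..<l}" "(!) ?gs" "set ?gs"]
    by (simp add: comp_def)
  have sub: "(!) xs ` p \<subseteq> ?\<phi> p" if "p \<in> cycle_edges l" for p
  proof -
    obtain i where i: "i < l" "p = ?c i" using \<open>p \<in> cycle_edges l\<close> edges by auto
    have \<phi>: "?\<phi> p = ?gs ! i" using inv_into_f_f[OF inj, of i] i by simp
    show ?thesis
    proof (cases "i < length es")
      case True
      then have "(i + 1) mod l = Suc i" using leng by simp
      then show ?thesis using True \<phi> i path by (auto simp: berge_path_def nth_append)
    next
      case False
      \<comment> \<open>This is the wrap-around index \<open>l - 1\<close>, whose cycle edge joins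
        \<open>l - 1\<close> to \<open>0\<close>.\<close>
      then have il: "i = length es" "l = Suc i" using i leng by auto
      have "xs \<noteq> []" using len \<open>l \<ge> 3\<close> by auto
      then have "xs ! 0 \<in> e" "xs ! i \<in> e" using e len il by (auto simp: hd_conv_nth last_conv_nth)
      then show ?thesis using il \<phi> i by simp
    qed
  qed
  have "inj_on ((!) xs) (cycle_verts l)" "(!) xs ` cycle_verts l \<subseteq> V"
    using path len assms(4)
    by (auto simp: berge_path_def cycle_verts_def inj_on_def nth_eq_iff_index_eq)
  then have "is_Berge (cycle_verts l) (cycle_edges l) V (set ?gs)"
    unfolding is_Berge_def using bij sub by blast
  moreover have "subhypergraph V (set ?gs) V E"
    using assms(5,6) e(1) by (auto simp: subhypergraph_def)
  ultimately show ?thesis unfolding Berge_free_def by blast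
qed

section \<open>Linear 3-graphs: neighbourhoods, blocked edges, path extension\<close>

locale linear_3_graph =
  fixes V :: "'a set" and E :: "'a set set"
  assumes finite_V: "finite V"
    and edge_subset: "e \<in> E \<Longrightarrow> e \<subseteq> V"
    and card_edge: "e \<in> E \<Longrightarrow> card e = 3"
    and card_Int_edges: "e \<in> E \<Longrightarrow> f \<in> E \<Longrightarrow> e \<noteq> f \<Longrightarrow> card (e \<inter> f) \<le> 1"
begin

lemma finite_E: "finite E"
  by (rule finite_subset[of _ "Pow V"]) (use edge_subset finite_V in auto)

lemma finite_edge: "e \<in> E \<Longrightarrow> finite e"
  using edge_subset finite_V finite_subset by blast

lemma edge_unique:
  assumes "e \<in> E" "f \<in> E" "x \<noteq> y" "x \<in> e" "y \<in> e" "x \<in> f" "y \<in> f"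
  shows "e = f"
proof (rule ccontr)
  assume "e \<noteq> f"
  have "card {x, y} \<le> card (e \<inter> f)" using assms finite_edge by (intro card_mono) auto
  then show False using card_Int_edges[OF assms(1,2) \<open>e \<noteq> f\<close>] \<open>x \<noteq> y\<close> by simp
qed

definition nbrs :: "'a \<Rightarrow> 'a set" where
  "nbrs v = \<Union>{e \<in> E. v \<in> e} - {v}"

lemma nbrs_subset: "nbrs v \<subseteq> V"
  using edge_subset by (auto simp: nbrs_def)

lemma finite_nbrs: "finite (nbrs v)"
  using nbrs_subset finite_V finite_subset by blast

lemma card_nbrs_le: "card (nbrs v) \<le> 2 * degree E v"
proof -
  have eq: "nbrs v = (\<Union>e\<in>{e \<in> E. v \<in> e}. e - {v})" by (auto simp: nbrs_def)
  have "card (nbrs v) \<le> (\<Sum>e\<in>{e \<in> E. v \<in> e}. card (e - {v}))"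
    unfolding eq by (rule card_UN_le) (simp add: finite_E)
  also have "\<dots> = (\<Sum>e\<in>{e \<in> E. v \<in> e}. 2)"
    using card_edge finite_edge by (intro sum.cong) (auto simp: card_Diff_singleton)
  finally show ?thesis by (simp add: degree_def mult.commute)
qed

text \<open>Choose a vertex of \<open>S\<close> on each such edge. Together with \<open>x\<close> it
  determines the edge by linearity, so the choice is injective.\<close>

lemma card_edges_meeting_le:
  assumes "finite S" "x \<notin> S"
  shows "card {f \<in> E. x \<in> f \<and> f \<inter> S \<noteq> {}} \<le> card S"
proof (rule card_inj_on_le)
  let ?s = "\<lambda>f. SOME s. s \<in> f \<inter> S"
  have s: "?s f \<in> f \<inter> S" if "f \<inter> S \<noteq> {}" for f
    by (rule someI_ex) (use that in blast)
  show "inj_on ?s {f \<in> E. x \<in> f \<and> f \<inter> S \<noteq> {}}"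
  proof (rule inj_onI)
    fix f g assume "f \<in> {f \<in> E. x \<in> f \<and> f \<inter> S \<noteq> {}}" "g \<in> {f \<in> E. x \<in> f \<and> f \<inter> S \<noteq> {}}"
      and "?s f = ?s g"
    then show "f = g" using edge_unique[of f g x "?s f"] s[of f] s[of g] assms(2) by auto
  qed
  show "?s ` {f \<in> E. x \<in> f \<and> f \<inter> S \<noteq> {}} \<subseteq> S" using s by blast
qed (rule assms)

lemma edge_avoiding_exists:
  assumes "F \<subseteq> E" "finite S" "x \<notin> S" "card S < degree F x"
  obtains f where "f \<in> F" "x \<in> f" "f \<inter> S = {}"
proof -
  have "\<exists>f\<in>F. x \<in> f \<and> f \<inter> S = {}"
  proof (rule ccontr)
    assume "\<not> ?thesis"
    then have "{f \<in> F. x \<in> f} \<subseteq> {f \<in> E. x \<in> f \<and> f \<inter> S \<noteq> {}}" using assms(1) by blast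
    then have "degree F x \<le> card {f \<in> E. x \<in> f \<and> f \<inter> S \<noteq> {}}"
      unfolding degree_def using finite_E by (intro card_mono) auto
    then show False using card_edges_meeting_le[OF assms(2,3)] assms(4) by linarith
  qed
  then show ?thesis using that by blast
qed

text \<open>An edge at the endpoint that avoids all earlier vertices is automatically unused, and by
  linearity each earlier vertex blocks at most one edge.\<close>

lemma berge_path_extend:
  assumes path: "berge_path xs es" "set es \<subseteq> F" and "F \<subseteq> E"
    and S: "finite S" "hd xs \<notin> S" "length es + card S < degree F (hd xs)"
  obtains f where "f \<in> F" "hd xs \<in> f" "f \<inter> S = {}"
    "\<And>y. y \<in> f \<Longrightarrow> y \<noteq> hd xs \<Longrightarrow> y \<notin> set xs \<and> berge_path (y # xs) (f # es)"
proof -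
  have ne: "xs \<noteq> []" and dist: "distinct xs" and len: "length (tl xs) = length es"
    using path by (auto simp: berge_path_def)
  have set: "set xs = insert (hd xs) (set (tl xs))" using ne by (metis list.set(2) list.collapse)
  have hd: "hd xs \<notin> set (tl xs)" using ne dist by (metis distinct.simps(2) list.collapse)
  \<comment> \<open>The tail has as many vertices as the path has edges. The head must not be
    blocked, since the new edge passes through it.\<close>
  have "card (set (tl xs) \<union> S) \<le> length es + card S"
    using card_Un_le[of "set (tl xs)" S] card_length[of "tl xs"] len by linarith
  then obtain f where f: "f \<in> F" "hd xs \<in> f" "f \<inter> (set (tl xs) \<union> S) = {}"
    using edge_avoiding_exists[of F "set (tl xs) \<union> S" "hd xs"] assms hd by force
  show ?thesis
  proof (rule that[of f])
    fix y assume y: "y \<in> f" "y \<noteq> hd xs"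
    have "y \<notin> set xs" using y f set by blast
    moreover have "f \<notin> set es" using berge_path_edge_meets_tl[OF path(1)] f by blast
    ultimately show "y \<notin> set xs \<and> berge_path (y # xs) (f # es)"
      using berge_path_Cons[OF path(1) f(2) y(1)] by blast
  qed (use f in auto)
qed

section \<open>Long Berge paths in dense subsets\<close>

text \<open>The head stays in \<open>Y\<close>, where its degree exceeds the number of edges used so
  far, so an edge avoiding all earlier vertices exists. Being dense, it has a second vertex in
  \<open>Y\<close> to move to.\<close>

lemma greedy_berge_path:
  assumes "F \<subseteq> E" "x \<in> Y" "\<And>y. y \<in> Y \<Longrightarrow> t \<le> degree (dense_edges F Y) y"
  shows "\<exists>xs es. berge_path xs es \<and> length es = t \<and> last xs = x \<and> set xs \<subseteq> Y
    \<and> set es \<subseteq> dense_edges F Y"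
  using assms(3)
proof (induction t)
  case 0
  have "berge_path [x] []" by (simp add: berge_path_def)
  then show ?case using assms(2) by (intro exI[of _ "[x]"] exI[of _ "[]"]) auto
next
  case (Suc t)
  then obtain xs es where p: "berge_path xs es" "length es = t" "last xs = x" "set xs \<subseteq> Y"
      "set es \<subseteq> dense_edges F Y"
    by (meson Suc_leD)
  have ne: "xs \<noteq> []" using p by (auto simp: berge_path_def)
  then have "t < degree (dense_edges F Y) (hd xs)" using Suc.prems p(4) hd_in_set
    by (meson Suc_le_lessD subsetD)
  moreover have FE: "dense_edges F Y \<subseteq> E" using assms(1) by (auto simp: dense_edges_def)
  ultimately obtain f where f: "f \<in> dense_edges F Y" "hd xs \<in> f"
    "\<And>y. y \<in> f \<Longrightarrow> y \<noteq> hd xs \<Longrightarrow> y \<notin> set xs \<and> berge_path (y # xs) (f # es)"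
    using berge_path_extend[OF p(1,5) FE, of "{}"] p(2) by auto
  have "\<not> f \<inter> Y \<subseteq> {hd xs}"
  proof
    assume "f \<inter> Y \<subseteq> {hd xs}"
    then have "card (f \<inter> Y) \<le> 1" using card_mono[of "{hd xs}" "f \<inter> Y"] by simp
    then show False using f(1) by (simp add: dense_edges_def)
  qed
  then obtain y where y: "y \<in> f" "y \<in> Y" "y \<noteq> hd xs" by blast
  show ?case using f(1) f(3)[OF y(1,3)] y p ne
    by (intro exI[of _ "y # xs"] exI[of _ "f # es"]) auto
qed

text \<open>Prepending \<open>v\<close> through \<open>e\<close> gives a path on \<open>l\<close>
  vertices, which \<open>f\<close> closes. Both edges are new because they contain \<open>v\<close>
  and those of \<open>es\<close> do not.\<close>

lemma closing_path_not_free: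
  assumes path: "berge_path xs es" and len: "length xs = l - 1" and "l \<ge> 5"
    and es: "set es \<subseteq> E" "\<And>e. e \<in> set es \<Longrightarrow> v \<notin> e" and xs: "set xs \<subseteq> V" "v \<notin> set xs"
    and e: "e \<in> E" "f \<in> E" "e \<noteq> f" "v \<in> e" "v \<in> f" "hd xs \<in> e" "last xs \<in> f"
  shows "\<not> Berge_free (cycle_verts l) (cycle_edges l) V E"
proof (rule berge_cycle_not_free)
  show "berge_path (v # xs) (e # es)"
    using es(2) e(4) by (intro berge_path_Cons[OF path e(6) e(4) xs(2)]) blast
  show "length (v # xs) = l" using len \<open>l \<ge> 5\<close> by simp
  show "last (v # xs) \<in> f" using e(7) len \<open>l \<ge> 5\<close> by auto
  show "set (v # xs) \<subseteq> V" using xs(1) edge_subset[OF e(1)] e(4) by auto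
qed (use assms edge_subset in auto)

text \<open>A dense vertex subset of large minimum degree carries a Berge path starting at a vertex of
  even larger degree; both its ends can be prolonged into the neighbourhood of \<open>v\<close>, and then \<open>v\<close>
  closes it to a Berge cycle.\<close>

lemma card_dense_edges_le:
  assumes free: "Berge_free (cycle_verts l) (cycle_edges l) V E" and "l \<ge> 5"
    and F: "F \<subseteq> E" "\<And>f. f \<in> F \<Longrightarrow> v \<notin> f" and X: "X \<subseteq> V" "v \<notin> X"
    and exit: "\<And>f x. f \<in> F \<Longrightarrow> x \<in> f \<Longrightarrow> x \<in> X \<Longrightarrow> 2 \<le> card (f \<inter> X) \<Longrightarrow> \<exists>y \<in> f \<inter> nbrs v. y \<noteq> x"
  shows "2 * card (dense_edges F X) \<le> (2 * l - 7) * card X"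
proof (rule ccontr)
  assume "\<not> ?thesis"
  moreover have "finite F" "finite X" using F X finite_E finite_V finite_subset by blast+
  ultimately obtain Y x where Y: "Y \<subseteq> X" "x \<in> Y" "2 * l - 7 < degree (dense_edges F Y) x"
    and low: "\<And>y. y \<in> Y \<Longrightarrow> 2 * l - 7 < 2 * degree (dense_edges F Y) y"
    using dense_subset_exists[of F X "2 * l - 7"] by (metis not_le)
  define G where "G = dense_edges F Y"
  \<comment> \<open>Degrees are integers, so more than \<open>(2 * l - 7) / 2\<close> means at least
    \<open>l - 3\<close>: enough to extend a path with \<open>l - 4\<close> edges once more.\<close>
  have low': "l - 4 < degree G y" if "y \<in> Y" for y
    using low[OF that] \<open>l \<ge> 5\<close> unfolding G_def by linarith
  have GE: "G \<subseteq> E" and Gv: "\<And>f. f \<in> G \<Longrightarrow> v \<notin> f" using F by (auto simp: G_def dense_edges_def)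
  have Gexit: "\<exists>y \<in> f \<inter> nbrs v. y \<noteq> x" if "f \<in> G" "x \<in> f" "x \<in> Y" for f x
  proof (rule exit)
    have "card (f \<inter> Y) \<le> card (f \<inter> X)"
      using Y(1) \<open>finite X\<close> by (intro card_mono) auto
    then show "2 \<le> card (f \<inter> X)" using that by (simp add: G_def dense_edges_def)
  qed (use that Y(1) in \<open>auto simp: G_def dense_edges_def\<close>)
  \<comment> \<open>The path has \<open>l - 4\<close> edges; one exit edge at each end makes
    \<open>l - 2\<close> edges and \<open>l - 1\<close> vertices, and \<open>v\<close> is the last
    vertex of the cycle.\<close>
  obtain xs es where p: "berge_path xs es" "length es = l - 4" "last xs = x" "set xs \<subseteq> Y"
    "set es \<subseteq> G"
    using greedy_berge_path[OF F(1) Y(2), of "l - 4"] low' unfolding G_def by (meson less_imp_le)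
  have ne: "xs \<noteq> []" using p by (auto simp: berge_path_def)
  then have hdY: "hd xs \<in> Y" using p(4) by auto
  obtain f where f: "f \<in> G" "hd xs \<in> f"
    "\<And>y. y \<in> f \<Longrightarrow> y \<noteq> hd xs \<Longrightarrow> y \<notin> set xs \<and> berge_path (y # xs) (f # es)"
    using berge_path_extend[OF p(1,5) GE, of "{}"] low'[OF hdY] p(2) by auto
  obtain a where a: "a \<in> f" "a \<in> nbrs v" "a \<noteq> hd xs" using Gexit[OF f(1,2) hdY] by blast
  have path1: "berge_path (a # xs) (f # es)" "a \<notin> set xs" using f(3) a by auto
  obtain e where e: "e \<in> E" "v \<in> e" "a \<in> e" "a \<noteq> v" using a(2) by (auto simp: nbrs_def)
  \<comment> \<open>\<open>S\<close> holds the third vertex of \<open>e\<close>, unless that is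
    \<open>x\<close>. Avoiding it keeps the second exit \<open>b\<close> off \<open>e\<close>, so
    that the two edges at \<open>v\<close> differ.\<close>
  define S where "S = e - {v} - {a} - {x}"
  have finS: "finite S" using finite_edge[OF e(1)] by (simp add: S_def)
  have "card (e - {v} - {a}) = 1" using e card_edge[OF e(1)] by (simp add: card_Diff_singleton)
  then have cardS: "card S \<le> 1" unfolding S_def
    by (metis card_Diff1_le)
  let ?xs = "rev (a # xs)" and ?es = "rev (f # es)"
  have path2: "berge_path ?xs ?es" using path1(1) by (rule berge_path_rev)
  have hd2: "hd ?xs = x" using p(3) ne by (simp add: hd_append hd_rev)
  \<comment> \<open>The left side is at most \<open>(l - 3) + 1\<close>, and
    \<open>l - 2 \<le> 2 * l - 7\<close> because \<open>l \<ge> 5\<close>. The larger degree of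
    \<open>x\<close> pays for avoiding \<open>S\<close>.\<close>
  have "length ?es + card S < degree G (hd ?xs)"
    unfolding hd2 using p(2) cardS Y(3) \<open>l \<ge> 5\<close> by (simp add: G_def)
  moreover have "hd ?xs \<notin> S" "set ?es \<subseteq> G"
    unfolding hd2 using p(5) f(1) by (auto simp: S_def)
  ultimately obtain g where g: "g \<in> G" "x \<in> g" "g \<inter> S = {}"
    "\<And>y. y \<in> g \<Longrightarrow> y \<noteq> x \<Longrightarrow> y \<notin> set ?xs \<and> berge_path (y # ?xs) (g # ?es)"
    using berge_path_extend[OF path2 _ GE finS] unfolding hd2 by metis
  obtain b where b: "b \<in> g" "b \<in> nbrs v" "b \<noteq> x" using Gexit[OF g(1,2) Y(2)] by blast
  have path3: "berge_path (b # ?xs) (g # ?es)" and "b \<noteq> a" using g(4)[OF b(1,3)] by auto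
  then have "b \<notin> e" using b g(1,3) Gv by (auto simp: S_def)
  obtain e' where e': "e' \<in> E" "v \<in> e'" "b \<in> e'" using b(2) by (auto simp: nbrs_def)
  have "e' \<noteq> e" using \<open>b \<notin> e\<close> e' by blast
  have "a \<noteq> v" "b \<noteq> v" "a \<in> V" "b \<in> V" using a b nbrs_subset by (auto simp: nbrs_def)
  then have xs: "set (b # ?xs) \<subseteq> V" "v \<notin> set (b # ?xs)" using p(4) X Y(1) by auto
  have es: "set (g # ?es) \<subseteq> G" using p(5) f(1) g(1) by auto
  have "length (b # ?xs) = l - 1" using p(1,2) \<open>l \<ge> 5\<close> by (simp add: berge_path_def)
  moreover have "hd (b # ?xs) \<in> e'" "last (b # ?xs) \<in> e" using e e' by auto
  ultimately have "\<not> Berge_free (cycle_verts l) (cycle_edges l) V E"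
    using closing_path_not_free[OF path3 _ \<open>l \<ge> 5\<close> _ _ xs e'(1) e(1) \<open>e' \<noteq> e\<close> e'(2) e(2)] es GE Gv
    by blast
  then show False using free by blast
qed

section \<open>The degree sum over a neighbourhood\<close>

text \<open>Each neighbour of \<open>v\<close> shares one edge with \<open>v\<close>. An edge
  avoiding \<open>v\<close> is counted once if it lies in \<open>F1\<close> and at most three times
  if it lies in \<open>F2\<close>, and the two classes are bounded through \<open>?B\<close> and
  \<open>?A\<close>.\<close>

lemma sum_degree_nbrs_le:
  assumes free: "Berge_free (cycle_verts l) (cycle_edges l) V E" and "l \<ge> 5" and v: "v \<in> V"
  shows "2 * (\<Sum>j\<in>nbrs v. degree E j)
    \<le> (2 * l - 7) * (card V - 1) + (4 * l - 12) * card (nbrs v)"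
proof -
  let ?A = "nbrs v" and ?B = "V - {v} - nbrs v"
  define F where "F = {f \<in> E. v \<notin> f}"
  define F1 where "F1 = {f \<in> F. card (f \<inter> ?A) = 1}"
  define F2 where "F2 = {f \<in> F. 2 \<le> card (f \<inter> ?A)}"
  have fin: "finite F" "finite F1" "finite F2"
    using finite_E by (auto simp: F_def F1_def F2_def)
  have vA: "v \<notin> ?A" by (simp add: nbrs_def)
  have B: "card (f \<inter> ?B) = 2" if "f \<in> F1" for f
  proof -
    have "f \<inter> ?B = f - (f \<inter> ?A)" using that edge_subset by (auto simp: F1_def F_def)
    moreover have "card (f - (f \<inter> ?A)) = card f - card (f \<inter> ?A)"
      using that finite_edge by (intro card_Diff_subset) (auto simp: F1_def F_def)
    ultimately show ?thesis using that card_edge by (auto simp: F1_def F_def)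
  qed
  \<comment> \<open>Two vertices of each edge in \<open>F1\<close> lie in \<open>?B\<close>, so all
    of \<open>F1\<close> is dense there; the third one is the exit into \<open>?A\<close>.\<close>
  have "2 * card (dense_edges F1 ?B) \<le> (2 * l - 7) * card ?B"
  proof (rule card_dense_edges_le[OF free \<open>l \<ge> 5\<close>])
    fix f x assume "f \<in> F1" "x \<in> f" "x \<in> ?B"
    then show "\<exists>y \<in> f \<inter> ?A. y \<noteq> x"
      by (auto simp: F1_def card_1_singleton_iff)
  qed (auto simp: F1_def F_def)
  moreover have "dense_edges F1 ?B = F1" using B by (auto simp: dense_edges_def)
  ultimately have 1: "2 * card F1 \<le> (2 * l - 7) * card ?B" by simp
  \<comment> \<open>Here the paths run inside \<open>?A\<close> itself, and a second vertex in
    \<open>?A\<close> serves as the exit.\<close>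
  have "2 * card (dense_edges F2 ?A) \<le> (2 * l - 7) * card ?A"
  proof (rule card_dense_edges_le[OF free \<open>l \<ge> 5\<close>])
    fix f x assume "2 \<le> card (f \<inter> ?A)"
    show "\<exists>y \<in> f \<inter> ?A. y \<noteq> x"
    proof (rule ccontr)
      assume "\<not> ?thesis"
      then have "f \<inter> ?A \<subseteq> {x}" by blast
      then have "card (f \<inter> ?A) \<le> 1" using card_mono[of "{x}" "f \<inter> ?A"] by simp
      then show False using \<open>2 \<le> card (f \<inter> ?A)\<close> by simp
    qed
  qed (use nbrs_subset vA in \<open>auto simp: F2_def F_def\<close>)
  moreover have "dense_edges F2 ?A = F2" by (auto simp: dense_edges_def F2_def)
  ultimately have 2: "2 * card F2 \<le> (2 * l - 7) * card ?A" by simp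
  have deg: "degree E j \<le> 1 + degree F j" if j: "j \<in> ?A" for j
  proof -
    have eq: "{e \<in> E. j \<in> e} = {e \<in> E. j \<in> e \<and> e \<inter> {v} \<noteq> {}} \<union> {e \<in> F. j \<in> e}"
      by (auto simp: F_def)
    have "degree E j \<le> card {e \<in> E. j \<in> e \<and> e \<inter> {v} \<noteq> {}} + degree F j"
      unfolding degree_def by (subst eq) (rule card_Un_le)
    moreover have "card {e \<in> E. j \<in> e \<and> e \<inter> {v} \<noteq> {}} \<le> 1"
      using card_edges_meeting_le[of "{v}" j] j by (auto simp: nbrs_def)
    ultimately show ?thesis by linarith
  qed
  have "(\<Sum>j\<in>?A. degree F j) = (\<Sum>f\<in>F. card {j \<in> ?A. j \<in> f})"
    unfolding degree_def by (rule sum_multicount_gen) (use fin finite_nbrs in auto)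
  also have "\<dots> \<le> (\<Sum>f\<in>F. (if f \<in> F1 then 1 else 0) + (if f \<in> F2 then 3 else 0))"
  proof (rule sum_mono)
    fix f assume f: "f \<in> F"
    have eq: "{j \<in> ?A. j \<in> f} = f \<inter> ?A" by blast
    have "card (f \<inter> ?A) \<le> card f" using f finite_edge by (intro card_mono) (auto simp: F_def)
    then have "card (f \<inter> ?A) \<le> 3" using f card_edge by (auto simp: F_def)
    then show "card {j \<in> ?A. j \<in> f} \<le> (if f \<in> F1 then 1 else 0) + (if f \<in> F2 then 3 else 0)"
      using f unfolding eq F1_def F2_def by auto
  qed
  also have "\<dots> = card F1 + 3 * card F2"
  proof -
    have "F \<inter> {f. f \<in> F1} = F1" "F \<inter> {f. f \<in> F2} = F2" by (auto simp: F1_def F2_def)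
    then show ?thesis using fin by (simp add: sum.distrib sum.If_cases)
  qed
  finally have W: "(\<Sum>j\<in>?A. degree F j) \<le> card F1 + 3 * card F2" .
  have "(\<Sum>j\<in>?A. degree E j) \<le> (\<Sum>j\<in>?A. 1 + degree F j)"
    using deg by (rule sum_mono)
  also have "\<dots> = card ?A + (\<Sum>j\<in>?A. degree F j)" by (simp only: sum.distrib card_eq_sum)
  finally have "2 * (\<Sum>j\<in>?A. degree E j)
      \<le> 2 * card ?A + (2 * l - 7) * card ?B + 3 * ((2 * l - 7) * card ?A)"
    using W 1 2 by linarith
  moreover have "card V - 1 = card ?A + card ?B"
  proof -
    have "card (V - {v}) = card (?A \<union> ?B)"
      using nbrs_subset vA by (intro arg_cong[where f = card]) auto
    also have "\<dots> = card ?A + card ?B"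
      using finite_nbrs finite_V by (intro card_Un_disjoint) auto
    finally show ?thesis using v by (simp add: card_Diff_singleton)
  qed
  \<comment> \<open>With \<open>c = 2 * l - 7\<close>, one of the three shares of
    \<open>c * card ?A\<close> joins \<open>c * card ?B\<close> to give
    \<open>c * (card V - 1)\<close>.\<close>
  moreover have "4 * l - 12 = 2 + 2 * (2 * l - 7)" using \<open>l \<ge> 5\<close> by simp
  moreover have "c * (a + b) + (2 + 2 * c) * a = 2 * a + c * b + 3 * (c * a)" for a b c :: nat
    by (simp add: algebra_simps)
  ultimately show ?thesis by (metis (no_types, lifting))
qed

section \<open>The eigenvalue equations of the tensor\<close>

text \<open>Ordered pairs match the index tuples of the tensor sum, so every edge at
  \<open>i\<close> occurs twice.\<close>

definition links :: "'a \<Rightarrow> ('a \<times> 'a) set" where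
  "links i = {(j, k) \<in> V \<times> V. {i, j, k} \<in> E}"

lemma distinct_edge:
  assumes "{i, j, k} \<in> E"
  shows "i \<noteq> j" "i \<noteq> k" "j \<noteq> k"
  using card_edge[OF assms] by (auto simp: card_insert_if split: if_splits)

text \<open>By linearity \<open>i\<close> and \<open>j\<close> determine the edge and hence its
  third vertex.\<close>

lemma bij_betw_links_nbrs: "bij_betw fst (links i) (nbrs i)"
  unfolding bij_betw_def
proof
  show "inj_on fst (links i)"
  proof (rule inj_onI)
    fix p q assume pq: "p \<in> links i" "q \<in> links i" "fst p = fst q"
    obtain j k where p: "p = (j, k)" by (cases p)
    obtain k' where q: "q = (j, k')" using pq(3) p by (cases q) auto
    have E: "{i, j, k} \<in> E" "{i, j, k'} \<in> E" using pq p q by (auto simp: links_def)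
    then have "{i, j, k} = {i, j, k'}" using distinct_edge[OF E(1)]
      by (intro edge_unique[of _ _ i j]) auto
    then have "k = k'" using distinct_edge[OF E(1)] by (metis insert_iff singletonD)
    then show "p = q" using p q by simp
  qed
  show "fst ` links i = nbrs i"
  proof
    show "fst ` links i \<subseteq> nbrs i"
    proof
      fix j assume "j \<in> fst ` links i"
      then obtain k where "{i, j, k} \<in> E" by (auto simp: links_def)
      moreover from this have "i \<noteq> j" by (rule distinct_edge)
      ultimately show "j \<in> nbrs i" by (auto simp: nbrs_def)
    qed
    show "nbrs i \<subseteq> fst ` links i"
    proof
      fix j assume "j \<in> nbrs i"
      then obtain e where e: "e \<in> E" "i \<in> e" "j \<in> e" "j \<noteq> i" by (auto simp: nbrs_def)
      then have "card (e - {i} - {j}) = 1" using card_edge[OF e(1)]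
        by (simp add: card_Diff_singleton)
      then obtain k where "e - {i} - {j} = {k}" by (auto simp: card_1_singleton_iff)
      then have "e = {i, j, k}" using e by blast
      then have "(j, k) \<in> links i" using e edge_subset[OF e(1)] by (simp add: links_def)
      then show "j \<in> fst ` links i" by force
    qed
  qed
qed

lemma sum_links_fst: "(\<Sum>(j, k)\<in>links i. g j) = (\<Sum>j\<in>nbrs i. g j)"
  using sum.reindex_bij_betw[OF bij_betw_links_nbrs, of g] by (simp add: case_prod_beta)

lemma sum_links_snd: "(\<Sum>(j, k)\<in>links i. g k) = (\<Sum>j\<in>nbrs i. g j)"
proof -
  have "(\<Sum>(j, k)\<in>links i. g k) = (\<Sum>(j, k)\<in>links i. g j)"
    by (rule sum.reindex_bij_witness[of _ prod.swap prod.swap])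
       (auto simp: links_def insert_commute)
  then show ?thesis by (simp add: sum_links_fst)
qed

text \<open>The degree tensor contributes only at the pair \<open>(i, i)\<close>, and the adjacency
  tensor, with entries \<open>1 / fact 2\<close>, only on \<open>links i\<close>.\<close>

lemma A_alpha_tensor_apply:
  assumes "i \<in> V"
  shows "(\<Sum>is \<in> {is. set is \<subseteq> V \<and> length is = 3 - 1}.
      A_alpha_tensor \<alpha> 3 E (i # is) * prod_list (map x is))
    = of_real \<alpha> * of_nat (degree E i) * x i ^ 2
      + of_real (1 - \<alpha>) / 2 * (\<Sum>(j, k)\<in>links i. x j * x k)"
    (is "?L = ?R")
proof -
  let ?T = "\<lambda>(j, k). A_alpha_tensor \<alpha> 3 E [i, j, k] * (x j * x k)"
  have lists: "{is. set is \<subseteq> V \<and> length is = 3 - 1} = (\<lambda>(j, k). [j, k]) ` (V \<times> V)"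
    by (auto simp: numeral_eq_Suc length_Suc_conv)
  have inj: "inj_on (\<lambda>(j, k). [j, k]) (V \<times> V)" by (auto simp: inj_on_def)
  have "?L = (\<Sum>p\<in>V \<times> V. ?T p)"
    unfolding lists by (subst sum.reindex[OF inj]) (auto intro!: sum.cong)
  also have "\<dots> = (\<Sum>p\<in>V \<times> V.
      (if p = (i, i) then of_real \<alpha> * of_nat (degree E i) * x i ^ 2 else 0)
      + (if p \<in> links i then of_real (1 - \<alpha>) / 2 * (x (fst p) * x (snd p)) else 0))"
  proof (rule sum.cong[OF refl])
    fix p assume "p \<in> V \<times> V"
    then obtain j k where p: "p = (j, k)" "j \<in> V" "k \<in> V" by blast
    have A: "A_alpha_tensor \<alpha> 3 E [i, j, k]
        = of_real \<alpha> * (if j = i \<and> k = i then of_nat (degree E i) else 0)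
          + of_real (1 - \<alpha>) * (if {i, j, k} \<in> E then 1 / 2 else 0)"
      by (simp add: A_alpha_tensor_def degree_tensor_def adjacency_tensor_def numeral_3_eq_3)
    have L: "p \<in> links i \<longleftrightarrow> {i, j, k} \<in> E" using p by (simp add: links_def)
    show "?T p = (if p = (i, i) then of_real \<alpha> * of_nat (degree E i) * x i ^ 2 else 0)
      + (if p \<in> links i then of_real (1 - \<alpha>) / 2 * (x (fst p) * x (snd p)) else 0)"
    proof (cases "{i, j, k} \<in> E")
      case True
      then have "j \<noteq> i" using distinct_edge by metis
      then show ?thesis unfolding L using True p(1) A by simp
    next
      case False
      then show ?thesis unfolding L using p(1) A by (simp add: power2_eq_square)
    qed
  qed
  also have "\<dots> = ?R"
  proof -
    have "V \<times> V \<inter> {p. p \<in> links i} = links i" by (auto simp: links_def)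
    then show ?thesis
      using finite_V assms
      by (simp add: sum.distrib sum.If_cases sum.delta sum_distrib_left case_prod_beta)
  qed
  finally show ?thesis .
qed

text \<open>Taking moduli and applying AM-GM to each \<open>x j * x k\<close> makes the equation
  linear in the squared moduli. Each neighbour occurs once as first and once as second coordinate of
  a link, which cancels the \<open>2\<close> of AM-GM; the remaining \<open>1 / 2\<close> is the
  tensor entry.\<close>

lemma eigenvector_ineq:
  assumes "i \<in> V" "0 \<le> \<alpha>" "\<alpha> < 1"
    and eig: "(\<Sum>is \<in> {is. set is \<subseteq> V \<and> length is = 3 - 1}.
      A_alpha_tensor \<alpha> 3 E (i # is) * prod_list (map x is)) = \<mu> * x i ^ (3 - 1)"
  shows "cmod \<mu> * (cmod (x i))\<^sup>2
    \<le> \<alpha> * real (degree E i) * (cmod (x i))\<^sup>2 + (1 - \<alpha>) * ((\<Sum>j\<in>nbrs i. (cmod (x j))\<^sup>2) / 2)"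
proof -
  have "cmod (\<Sum>(j, k)\<in>links i. x j * x k) \<le> (\<Sum>(j, k)\<in>links i. ((cmod (x j))\<^sup>2 + (cmod (x k))\<^sup>2) / 2)"
  proof (rule sum_norm_le, clarify)
    fix j k
    show "cmod (x j * x k) \<le> ((cmod (x j))\<^sup>2 + (cmod (x k))\<^sup>2) / 2"
      using sum_squares_bound[of "cmod (x j)" "cmod (x k)"] by (simp add: norm_mult)
  qed
  also have "\<dots> = ((\<Sum>(j, k)\<in>links i. (cmod (x j))\<^sup>2) + (\<Sum>(j, k)\<in>links i. (cmod (x k))\<^sup>2)) / 2"
    by (simp add: case_prod_beta sum.distrib flip: sum_divide_distrib)
  also have "\<dots> = (\<Sum>j\<in>nbrs i. (cmod (x j))\<^sup>2)"
    by (simp add: sum_links_fst[of "\<lambda>j. (cmod (x j))\<^sup>2"] sum_links_snd[of "\<lambda>j. (cmod (x j))\<^sup>2"])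
  finally have S: "cmod (\<Sum>(j, k)\<in>links i. x j * x k) \<le> (\<Sum>j\<in>nbrs i. (cmod (x j))\<^sup>2)" .
  have "cmod \<mu> * (cmod (x i))\<^sup>2 = cmod (\<mu> * x i ^ (3 - 1))"
    by (simp add: norm_mult norm_power)
  also have "\<dots> = cmod (of_real \<alpha> * of_nat (degree E i) * x i ^ 2
      + of_real (1 - \<alpha>) / 2 * (\<Sum>(j, k)\<in>links i. x j * x k))"
    unfolding eig[symmetric] A_alpha_tensor_apply[OF assms(1)] ..
  also have "\<dots> \<le> cmod (of_real \<alpha> * of_nat (degree E i) * x i ^ 2)
      + cmod (of_real (1 - \<alpha>) / 2 * (\<Sum>(j, k)\<in>links i. x j * x k))"
    by (rule norm_triangle_ineq)
  also have "cmod (of_real \<alpha> * of_nat (degree E i) * x i ^ 2)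
      = \<alpha> * real (degree E i) * (cmod (x i))\<^sup>2"
    using assms(2) by (simp add: norm_mult norm_power)
  also have "cmod (of_real (1 - \<alpha>) / 2 * (\<Sum>(j, k)\<in>links i. x j * x k))
      = (1 - \<alpha>) * (cmod (\<Sum>(j, k)\<in>links i. x j * x k) / 2)"
    using assms(3) by (simp only: norm_mult norm_divide norm_of_real) simp
  also have "\<dots> \<le> (1 - \<alpha>) * ((\<Sum>j\<in>nbrs i. (cmod (x j))\<^sup>2) / 2)"
    using assms(3) S by (intro mult_left_mono divide_right_mono) auto
  finally show ?thesis by simp
qed

section \<open>From the shadow graph to a bound on eigenvalues\<close>

lemma nbrs_sym: "j \<in> nbrs i \<longleftrightarrow> i \<in> nbrs j"
  by (auto simp: nbrs_def)

text \<open>The left-hand side is \<open>\<parallel>A z\<parallel>\<^sup>2\<close> for the adjacency matrix \<open>A\<close> of the shadow graph, and \<open>4 K\<close>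
  bounds the row sums of \<open>A\<^sup>2\<close>.\<close>

lemma sum_nbrs_square_le:
  fixes z :: "'a \<Rightarrow> real"
  assumes K: "\<And>v. v \<in> V \<Longrightarrow> real (\<Sum>j\<in>nbrs v. degree E j) \<le> 2 * K"
  shows "(\<Sum>i\<in>V. (\<Sum>j\<in>nbrs i. z j)\<^sup>2) \<le> 4 * K * (\<Sum>i\<in>V. (z i)\<^sup>2)"
proof -
  have nb: "{j \<in> V. j \<in> nbrs i} = nbrs i" "{j \<in> V. i \<in> nbrs j} = nbrs i" for i
    using nbrs_subset nbrs_sym by auto
  have "(\<Sum>i\<in>V. (\<Sum>j\<in>nbrs i. z j)\<^sup>2) \<le> (\<Sum>i\<in>V. \<Sum>j\<in>nbrs i. 2 * real (degree E i) * (z j)\<^sup>2)"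
  proof (rule sum_mono)
    fix i
    \<comment> \<open>Cauchy-Schwarz, with the number of terms at most twice the degree.\<close>
    have "(\<Sum>j\<in>nbrs i. z j)\<^sup>2 \<le> (\<Sum>j\<in>nbrs i. (z j)\<^sup>2) * real (card (nbrs i))"
      by (rule sum_squared_le_sum_of_squares)
    also have "\<dots> \<le> (\<Sum>j\<in>nbrs i. (z j)\<^sup>2) * (2 * real (degree E i))"
      using card_nbrs_le[of i] by (intro mult_left_mono sum_nonneg) auto
    finally show "(\<Sum>j\<in>nbrs i. z j)\<^sup>2 \<le> (\<Sum>j\<in>nbrs i. 2 * real (degree E i) * (z j)\<^sup>2)"
      by (simp add: sum_distrib_left mult.commute)
  qed
  \<comment> \<open>Exchanging the sums, by symmetry of adjacency, turns the coefficient of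
    \<open>(z j)\<^sup>2\<close> into twice the degree sum over \<open>nbrs j\<close>.\<close>
  also have "\<dots> = (\<Sum>j\<in>V. \<Sum>i\<in>nbrs j. 2 * real (degree E i) * (z j)\<^sup>2)"
    using sum.swap_restrict[OF finite_V finite_V,
        of "\<lambda>i j. 2 * real (degree E i) * (z j)\<^sup>2" "\<lambda>i j. j \<in> nbrs i"]
    by (simp only: nb)
  also have "\<dots> = (\<Sum>j\<in>V. 2 * real (\<Sum>i\<in>nbrs j. degree E i) * (z j)\<^sup>2)"
    by (simp add: sum_distrib_left sum_distrib_right)
  also have "\<dots> \<le> (\<Sum>j\<in>V. 4 * K * (z j)\<^sup>2)"
    using K by (intro sum_mono mult_right_mono) auto
  finally show ?thesis by (simp add: sum_distrib_left)
qed

lemma convex_combination_square_le: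
  fixes a b \<alpha> :: real
  assumes "0 \<le> \<alpha>" "\<alpha> \<le> 1"
  shows "(\<alpha> * a + (1 - \<alpha>) * b)\<^sup>2 \<le> \<alpha> * a\<^sup>2 + (1 - \<alpha>) * b\<^sup>2"
proof -
  have "\<alpha> * a\<^sup>2 + (1 - \<alpha>) * b\<^sup>2 - (\<alpha> * a + (1 - \<alpha>) * b)\<^sup>2 = \<alpha> * (1 - \<alpha>) * (a - b)\<^sup>2"
    by (simp add: power2_eq_square algebra_simps)
  moreover have "0 \<le> \<alpha> * (1 - \<alpha>) * (a - b)\<^sup>2" using assms by simp
  ultimately show ?thesis by linarith
qed

lemma degree_le_max_degree: "i \<in> V \<Longrightarrow> degree E i \<le> max_degree V E"
  unfolding max_degree_def using finite_V by (intro Max_ge) auto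

text \<open>Square the inequality at each vertex, move the square inside the convex combination, sum
  over \<open>V\<close>, and cancel the positive sum of the \<open>(z i)\<^sup>2\<close>. The
  squared \<open>1 / 2\<close> cancels the factor \<open>4\<close> of \<open>4 * K\<close>.\<close>

lemma eigenvalue_bound:
  assumes \<alpha>: "0 \<le> \<alpha>" "\<alpha> < 1" and eig: "tensor_eigenvalue 3 V (A_alpha_tensor \<alpha> 3 E) \<mu>"
    and K: "\<And>v. v \<in> V \<Longrightarrow> real (\<Sum>j\<in>nbrs v. degree E j) \<le> 2 * K"
  shows "(cmod \<mu>)\<^sup>2 \<le> \<alpha> * (real (max_degree V E))\<^sup>2 + (1 - \<alpha>) * K"
proof -
  let ?D = "real (max_degree V E)"
  obtain x i0 where x: "i0 \<in> V" "x i0 \<noteq> 0"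
    and eq: "\<And>i. i \<in> V \<Longrightarrow> (\<Sum>is \<in> {is. set is \<subseteq> V \<and> length is = 3 - 1}.
      A_alpha_tensor \<alpha> 3 E (i # is) * prod_list (map x is)) = \<mu> * x i ^ (3 - 1)"
    using eig unfolding tensor_eigenvalue_def by blast
  define z where "z i = (cmod (x i))\<^sup>2" for i
  have pos: "0 < (\<Sum>i\<in>V. (z i)\<^sup>2)"
    using finite_V x by (intro sum_pos2[of _ i0]) (auto simp: z_def)
  have "(cmod \<mu>)\<^sup>2 * (z i)\<^sup>2 \<le> \<alpha> * (?D\<^sup>2 * (z i)\<^sup>2) + (1 - \<alpha>) * ((\<Sum>j\<in>nbrs i. z j)\<^sup>2 / 4)"
    if i: "i \<in> V" for i
  proof -
    have "cmod \<mu> * z i \<le> \<alpha> * real (degree E i) * z i + (1 - \<alpha>) * ((\<Sum>j\<in>nbrs i. z j) / 2)"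
      using eigenvector_ineq[OF i \<alpha> eq[OF i]] by (simp add: z_def)
    also have "\<dots> \<le> \<alpha> * (?D * z i) + (1 - \<alpha>) * ((\<Sum>j\<in>nbrs i. z j) / 2)"
      using \<alpha> degree_le_max_degree[OF i]
      by (simp add: mult.assoc mult_left_mono mult_right_mono z_def)
    finally have "(cmod \<mu> * z i)\<^sup>2 \<le> (\<alpha> * (?D * z i) + (1 - \<alpha>) * ((\<Sum>j\<in>nbrs i. z j) / 2))\<^sup>2"
      by (intro power_mono) (auto simp: z_def)
    also have "\<dots> \<le> \<alpha> * (?D * z i)\<^sup>2 + (1 - \<alpha>) * ((\<Sum>j\<in>nbrs i. z j) / 2)\<^sup>2"
      using \<alpha> by (intro convex_combination_square_le) auto
    finally show ?thesis by (simp add: power_mult_distrib power_divide)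
  qed
  then have "(\<Sum>i\<in>V. (cmod \<mu>)\<^sup>2 * (z i)\<^sup>2)
      \<le> (\<Sum>i\<in>V. \<alpha> * (?D\<^sup>2 * (z i)\<^sup>2) + (1 - \<alpha>) * ((\<Sum>j\<in>nbrs i. z j)\<^sup>2 / 4))"
    by (rule sum_mono)
  then have "(cmod \<mu>)\<^sup>2 * (\<Sum>i\<in>V. (z i)\<^sup>2)
      \<le> \<alpha> * ?D\<^sup>2 * (\<Sum>i\<in>V. (z i)\<^sup>2) + (1 - \<alpha>) * ((\<Sum>i\<in>V. (\<Sum>j\<in>nbrs i. z j)\<^sup>2) / 4)"
    by (simp add: sum.distrib sum_distrib_left sum_divide_distrib mult.assoc)
  also have "\<dots> \<le> \<alpha> * ?D\<^sup>2 * (\<Sum>i\<in>V. (z i)\<^sup>2) + (1 - \<alpha>) * (4 * K * (\<Sum>i\<in>V. (z i)\<^sup>2) / 4)"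
    using sum_nbrs_square_le[OF K, of z] \<alpha>
    by (intro add_left_mono mult_left_mono divide_right_mono) auto
  also have "\<dots> = (\<alpha> * ?D\<^sup>2 + (1 - \<alpha>) * K) * (\<Sum>i\<in>V. (z i)\<^sup>2)"
    by (simp add: algebra_simps)
  finally show ?thesis using pos by (simp add: mult_le_cancel_right)
qed

text \<open>Every unit vector is an eigenvector. Without some eigenvalue the supremum defining the
  spectral radius would be unspecified.\<close>

lemma tensor_eigenvalue_degree:
  assumes "i \<in> V"
  shows "tensor_eigenvalue 3 V (A_alpha_tensor \<alpha> 3 E) (of_real \<alpha> * of_nat (degree E i))"
  unfolding tensor_eigenvalue_def
proof (intro exI[of _ "\<lambda>j. if j = i then 1 else 0"] conjI ballI)
  let ?x = "\<lambda>j. if j = i then 1 else 0 :: complex"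
  \<comment> \<open>No link pairs a vertex with itself, so at least one factor of
    \<open>?x a * ?x b\<close> is zero.\<close>
  fix j assume j: "j \<in> V"
  have "?x a * ?x b = 0" if "(a, b) \<in> links j" for a b
    using that distinct_edge(3) by (auto simp: links_def)
  then have "(\<Sum>(a, b)\<in>links j. ?x a * ?x b) = 0"
    by (intro sum.neutral) auto
  then show "(\<Sum>is \<in> {is. set is \<subseteq> V \<and> length is = 3 - 1}.
      A_alpha_tensor \<alpha> 3 E (j # is) * prod_list (map ?x is))
    = of_real \<alpha> * of_nat (degree E i) * ?x j ^ (3 - 1)"
    unfolding A_alpha_tensor_apply[OF j] by simp
qed (use assms in auto)

end

section \<open>From eigenvalues to the spectral radius\<close>

theorem theorem3p2:
  fixes V :: "'a set" and E :: "'a set set" and n l \<Delta> :: nat and \<alpha> :: real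
  assumes "n \<ge> 3" and "l \<ge> 5" and "0 \<le> \<alpha>" and "\<alpha> < 1"
    and "k_graph 3 V E" and "linear_hypergraph E" and "connected_hypergraph V E"
    and "card V = n" and "\<Delta> = max_degree V E"
    and "Berge_free (cycle_verts l) (cycle_edges l) V E"
  shows "(rho_alpha \<alpha> 3 V E)\<^sup>2 \<le> \<alpha> * (real \<Delta>)\<^sup>2 +
    (1 - \<alpha>) * ((2 * real l - 7) * (real n - 1) / 4 + (2 * real l - 3) * real \<Delta>)"
proof -
  interpret linear_3_graph V E
    using assms(5,6) unfolding k_graph_def linear_hypergraph_def by unfold_locales blast+
  let ?K = "(2 * real l - 7) * (real n - 1) / 4 + (2 * real l - 3) * real \<Delta>"
  let ?B = "\<alpha> * (real \<Delta>)\<^sup>2 + (1 - \<alpha>) * ?K"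
  let ?S = "{cmod \<mu> | \<mu>. tensor_eigenvalue 3 V (A_alpha_tensor \<alpha> 3 E) \<mu>}"
  have K: "real (\<Sum>j\<in>nbrs v. degree E j) \<le> 2 * ?K" if v: "v \<in> V" for v
  proof -
    have "real (2 * (\<Sum>j\<in>nbrs v. degree E j))
        \<le> real ((2 * l - 7) * (card V - 1) + (4 * l - 12) * card (nbrs v))"
      using sum_degree_nbrs_le[OF assms(10,2) v] by (rule of_nat_mono)
    also have "\<dots> = (2 * real l - 7) * (real n - 1) + (4 * real l - 12) * real (card (nbrs v))"
      using assms(1,2,8) by (simp add: of_nat_diff)
    also have "\<dots> \<le> (2 * real l - 7) * (real n - 1) + (4 * real l - 12) * (2 * real \<Delta>)"
      using card_nbrs_le[of v] degree_le_max_degree[OF v] assms(2,9)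
      by (intro add_left_mono mult_left_mono) auto
    \<comment> \<open>The coefficient \<open>8 * l - 24\<close> of \<open>\<Delta>\<close> is
      relaxed to \<open>8 * l - 12\<close>, four times the one in \<open>?K\<close>.\<close>
    also have "\<dots> \<le> (2 * real l - 7) * (real n - 1) + (8 * real l - 12) * real \<Delta>"
      by (simp add: algebra_simps)
    also have "\<dots> = 4 * ?K" by (simp add: field_simps)
    finally show ?thesis by linarith
  qed
  have bound: "(cmod \<mu>)\<^sup>2 \<le> ?B" if "tensor_eigenvalue 3 V (A_alpha_tensor \<alpha> 3 E) \<mu>" for \<mu>
    using eigenvalue_bound[OF assms(3,4) that K] assms(9) by simp
  have le: "s \<le> sqrt ?B" if "s \<in> ?S" for s
    using that bound by (auto intro!: real_le_rsqrt)
  obtain i where "i \<in> V" using assms(1,8) by fastforce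
  then obtain \<mu> where \<mu>: "tensor_eigenvalue 3 V (A_alpha_tensor \<alpha> 3 E) \<mu>"
    using tensor_eigenvalue_degree by blast
  then have mem: "cmod \<mu> \<in> ?S" by blast
  have "bdd_above ?S" using le by (rule bdd_aboveI)
  then have "cmod \<mu> \<le> rho_alpha \<alpha> 3 V E"
    unfolding rho_alpha_def tensor_spectral_radius_def using mem by (intro cSup_upper)
  \<comment> \<open>Squaring the upper bound requires a nonnegative supremum; an existing eigenvalue
    provides this.\<close>
  then have "0 \<le> rho_alpha \<alpha> 3 V E" using norm_ge_zero order_trans by blast
  moreover have "rho_alpha \<alpha> 3 V E \<le> sqrt ?B"
    unfolding rho_alpha_def tensor_spectral_radius_def using mem le by (intro cSup_least) auto
  ultimately have "(rho_alpha \<alpha> 3 V E)\<^sup>2 \<le> (sqrt ?B)\<^sup>2" by (rule power_mono[rotated])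
  moreover have "0 \<le> ?B" using bound[OF \<mu>] zero_le_power2 order_trans by blast
  ultimately show ?thesis by simp
qed

end
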